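(* (Relevant Karp's Theorem) Let $(M_1,w_1)$ and $(M_2,w_2)$ be two pointed Routley–Meyer models and $\{i,j\}=\{1,2\}$. Then the following are equivalent: (i) for every formula $\phi$ of $L_{\infty\omega}^{\rightarrow}$, $M_i,w_i\Vdash\phi$ only if $M_j,w_j\Vdash\phi$; (ii) there is a relevant directed bisimulation $\langle Z_1,Z_2\rangle$ for $\mathtt{PROP}$ between $M_1$ and $M_2$ such that $w_iZ_iw_j$.
   Context: Language. Given a set $\mathtt{PROP}$ of propositional variables, the formulas of $L_{\infty\omega}^{\rightarrow}$ are generated by $\phi ::= p \mid \bot \mid {\sim}\phi \mid \bigwedge_{i\in I}\phi_i \mid \bigvee_{i\in I}\phi_i \mid \phi\rightarrow\psi$, with $p\in\mathtt{PROP}$ and $I$ an arbitrary set. Models. A (Routley–Meyer) model is $M=\langle W,R,*,T,V\rangle$ with $W$ a non-empty set, $T\in W$ (often omitted), $*:W\to W$ (written $w\mapsto w^*$), $R\subseteq W^3$, and $V:\mathtt{PROP}\to\wp(W)$. A pointed model is a pair $(M,w)$ with $w\in W$. Satisfaction: $M,w\Vdash\bot$ never; $M,w\Vdash p$ iff $w\in V(p)$; $M,w\Vdash{\sim}\phi$ iff $M,w^*\nVdash\phi$; $M,w\Vdash\bigwedge_{i\in I}\phi_i$ iff $M,w\Vdash\phi_i$ for every $i\in I$; $M,w\Vdash\bigvee_{i\in I}\phi_i$ iff $M,w\Vdash\phi_i$ for some $i\in I$; $M,w\Vdash\phi\rightarrow\psi$ iff for all $a,b$ with $Rwab$, if $M,a\Vdash\phi$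 then $M,b\Vdash\psi$. Relevant directed bisimulations. Let $M_1=\langle W_1,R_1,*_1,V_1\rangle$ and $M_2=\langle W_2,R_2,*_2,V_2\rangle$ be models. A relevant directed bisimulation for $\mathtt{PROP}$ between $M_1$ and $M_2$ is a pair $\langle Z_1,Z_2\rangle$ of non-empty relations $Z_1\subseteq W_1\times W_2$, $Z_2\subseteq W_2\times W_1$ such that whenever $\{i,j\}=\{1,2\}$: (1) $xZ_iy$ only if $y^{*_j}Z_jx^{*_i}$; (2) if $xZ_iy$ and $R_jybc$ for some $b,c\in W_j$, there are $b',c'\in W_i$ such that $R_ixb'c'$, $bZ_jb'$ and $c'Z_ic$; (3) if $xZ_iy$ and $p\in\mathtt{PROP}$, then $M_i,x\Vdash p$ only if $M_j,y\Vdash p$. *)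

theory Defs
  imports Main
begin

text \<open>
  The index sets of the infinitary connectives are the subsets of the type \<^typ>\<open>'i\<close>; a family
  \<open>(\<phi>\<^sub>i)\<close> over \<open>I\<close> is a function of which only the values on \<open>I\<close> matter.
\<close>

datatype ('p, 'i) fm =
    Var 'p
  | Falsum
  | Neg "('p, 'i) fm"
  | Conj "'i set" "'i \<Rightarrow> ('p, 'i) fm"
  | Disj "'i set" "'i \<Rightarrow> ('p, 'i) fm"
  | Imp "('p, 'i) fm" "('p, 'i) fm"

inductive_set formulas :: "'p set \<Rightarrow> ('p, 'i) fm set" for Vars :: "'p set" where
  Var: "p \<in> Vars \<Longrightarrow> Var p \<in> formulas Vars"
| Falsum: "Falsum \<in> formulas Vars"
| Neg: "\<phi> \<in> formulas Vars \<Longrightarrow> Neg \<phi> \<in> formulas Vars"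
| Conj: "(\<And>i. i \<in> I \<Longrightarrow> f i \<in> formulas Vars) \<Longrightarrow> Conj I f \<in> formulas Vars"
| Disj: "(\<And>i. i \<in> I \<Longrightarrow> f i \<in> formulas Vars) \<Longrightarrow> Disj I f \<in> formulas Vars"
| Imp: "\<phi> \<in> formulas Vars \<Longrightarrow> \<psi> \<in> formulas Vars \<Longrightarrow> Imp \<phi> \<psi> \<in> formulas Vars"

record ('w, 'p) rm_model =
  worlds :: "'w set"
  rel :: "('w \<times> 'w \<times> 'w) set"
  star :: "'w \<Rightarrow> 'w"
  base :: 'w
  val :: "'p \<Rightarrow> 'w set"

definition routley_meyer_model :: "'p set \<Rightarrow> ('w, 'p) rm_model \<Rightarrow> bool" where
  "routley_meyer_model Vars M \<longleftrightarrow>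
     worlds M \<noteq> {} \<and>
     rel M \<subseteq> worlds M \<times> worlds M \<times> worlds M \<and>
     (\<forall>w\<in>worlds M. star M w \<in> worlds M) \<and>
     base M \<in> worlds M \<and>
     (\<forall>p\<in>Vars. val M p \<subseteq> worlds M)"

primrec sat :: "('w, 'p) rm_model \<Rightarrow> 'w \<Rightarrow> ('p, 'i) fm \<Rightarrow> bool" where
  "sat M w (Var p) \<longleftrightarrow> w \<in> val M p"
| "sat M w Falsum \<longleftrightarrow> False"
| "sat M w (Neg \<phi>) \<longleftrightarrow> \<not> sat M (star M w) \<phi>"
| "sat M w (Conj I f) \<longleftrightarrow> (\<forall>i\<in>I. sat M w (f i))"
| "sat M w (Disj I f) \<longleftrightarrow> (\<exists>i\<in>I. sat M w (f i))"
| "sat M w (Imp \<phi> \<psi>) \<longleftrightarrow> (\<forall>a b. (w, a, b) \<in> rel M \<longrightarrow> sat M a \<phi> \<longrightarrow> sat M b \<psi>)"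

text \<open>The three clauses for one choice of \<open>(i, j)\<close>, with \<open>M = M\<^sub>i\<close>, \<open>N = M\<^sub>j\<close>, \<open>Z = Z\<^sub>i\<close>, \<open>Z' = Z\<^sub>j\<close>.\<close>

definition directed_clauses ::
  "'p set \<Rightarrow> ('a, 'p) rm_model \<Rightarrow> ('b, 'p) rm_model \<Rightarrow> ('a \<times> 'b) set \<Rightarrow> ('b \<times> 'a) set \<Rightarrow> bool" where
  "directed_clauses Vars M N Z Z' \<longleftrightarrow>
     (\<forall>x y. (x, y) \<in> Z \<longrightarrow> (star N y, star M x) \<in> Z') \<and>
     (\<forall>x y b c. (x, y) \<in> Z \<longrightarrow> (y, b, c) \<in> rel N \<longrightarrow>
        (\<exists>b' c'. (x, b', c') \<in> rel M \<and> (b, b') \<in> Z' \<and> (c', c) \<in> Z)) \<and>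
     (\<forall>x y. \<forall>p\<in>Vars. (x, y) \<in> Z \<longrightarrow> x \<in> val M p \<longrightarrow> y \<in> val N p)"

definition relevant_directed_bisimulation ::
  "'p set \<Rightarrow> ('a, 'p) rm_model \<Rightarrow> ('b, 'p) rm_model \<Rightarrow> ('a \<times> 'b) set \<Rightarrow> ('b \<times> 'a) set \<Rightarrow> bool" where
  "relevant_directed_bisimulation Vars M1 M2 Z1 Z2 \<longleftrightarrow>
     Z1 \<subseteq> worlds M1 \<times> worlds M2 \<and> Z1 \<noteq> {} \<and>
     Z2 \<subseteq> worlds M2 \<times> worlds M1 \<and> Z2 \<noteq> {} \<and>
     directed_clauses Vars M1 M2 Z1 Z2 \<and>
     directed_clauses Vars M2 M1 Z2 Z1"

text \<open>
  HOL cannot quantify over all index sets at once, only over those inside a given type. The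
  following shows that a larger index type loses no formulas: every formula over \<^typ>\<open>'i\<close> has a
  copy over each index type into which \<^typ>\<open>'i\<close> injects. An index type that is too small for the
  models at hand yields a language too weak for a Karp theorem; \<^typ>\<open>'a + 'b + 'i\<close>, with \<^typ>\<open>'a\<close> and
  \<^typ>\<open>'b\<close> the types of worlds and \<^typ>\<open>'i\<close> arbitrary, is always large enough and as large as desired.
\<close>

primrec reindex :: "('i \<Rightarrow> 'j) \<Rightarrow> ('p, 'i) fm \<Rightarrow> ('p, 'j) fm" where
  "reindex h (Var p) = Var p"
| "reindex h Falsum = Falsum"
| "reindex h (Neg \<phi>) = Neg (reindex h \<phi>)"
| "reindex h (Conj I f) = Conj (h ` I) (\<lambda>j. reindex h (f (inv h j)))"
| "reindex h (Disj I f) = Disj (h ` I) (\<lambda>j. reindex h (f (inv h j)))"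
| "reindex h (Imp \<phi> \<psi>) = Imp (reindex h \<phi>) (reindex h \<psi>)"

lemma reindex_in_formulas:
  assumes "inj h" and "\<phi> \<in> formulas Vars"
  shows "reindex h \<phi> \<in> formulas Vars"
  using assms(2) by induction (auto intro!: formulas.intros simp: assms(1))

lemma sat_reindex:
  assumes "inj h"
  shows "sat M w (reindex h \<phi>) \<longleftrightarrow> sat M w \<phi>"
  by (induction \<phi> arbitrary: w) (auto simp: assms)

end

theory Submission imports Defs begin

text \<open>
  Preservation along a bisimulation is proved for both relations at once, as negation and implication
  switch sides. Conversely, inclusion of theories, taken in both directions, is itself a bisimulation:
  if the back clause failed at \<open>x\<close>, \<open>y\<close> and \<open>R y b c\<close>, choose for each \<open>b'\<close> a formula that separates \<open>b\<close>
  from \<open>b'\<close> and for each \<open>c'\<close> one that separates \<open>c'\<close> from \<open>c\<close>, where they exist; the implication from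
  the conjunction of the former to the disjunction of the latter holds at \<open>x\<close> but not at \<open>y\<close>.
\<close>

lemma sat_preserved:
  assumes "directed_clauses Vars M N Z Z'" and "directed_clauses Vars N M Z' Z"
    and "\<phi> \<in> formulas Vars"
  shows "(\<forall>x y. (x, y) \<in> Z \<longrightarrow> sat M x \<phi> \<longrightarrow> sat N y \<phi>) \<and>
         (\<forall>y x. (y, x) \<in> Z' \<longrightarrow> sat N y \<phi> \<longrightarrow> sat M x \<phi>)"
  using assms(3)
proof induction
  case (Var p)
  then show ?case using assms(1,2) unfolding directed_clauses_def by auto
next
  case (Neg \<phi>)
  then show ?case using assms(1,2) unfolding directed_clauses_def by (metis sat.simps(3))
next
  case (Imp \<phi> \<psi>)
  \<comment> \<open>For \<open>(y, b, c)\<close> in \<open>rel N\<close>, the back clause gives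
    \<open>b'\<close> and \<open>c'\<close>; then \<phi> travels from \<open>b\<close> to
    \<open>b'\<close> along \<open>Z'\<close>, and \<psi> from \<open>c'\<close> to \<open>c\<close>
    along \<open>Z\<close>.\<close>
  have "sat N y (Imp \<phi> \<psi>)" if "(x, y) \<in> Z" "sat M x (Imp \<phi> \<psi>)" for x y
    using assms(1) Imp.IH that unfolding directed_clauses_def sat.simps by metis
  moreover have "sat M x (Imp \<phi> \<psi>)" if "(y, x) \<in> Z'" "sat N y (Imp \<phi> \<psi>)" for x y
    using assms(2) Imp.IH that unfolding directed_clauses_def sat.simps by metis
  ultimately show ?case by blast
qed (simp, fastforce+)

text \<open>Taking the formulas as an argument lets the index type appear in the type of the
  constant.\<close>

definition theory_incl ::
  "('p, 'i) fm set \<Rightarrow> ('a, 'p) rm_model \<Rightarrow> ('b, 'p) rm_model \<Rightarrow> ('a \<times> 'b) set" where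
  "theory_incl F M N =
     {(x, y) \<in> worlds M \<times> worlds N. \<forall>\<phi>\<in>F. sat M x \<phi> \<longrightarrow> sat N y \<phi>}"

text \<open>Only the worlds of \<open>M\<close> have to inject into the index type: conjuncts and
  disjuncts are indexed by the candidate witnesses \<open>b'\<close> and \<open>c'\<close> of the
  back clause, which lie in \<open>M\<close>.\<close>

lemma directed_clauses_theory_incl:
  fixes M :: "('a, 'p) rm_model" and N :: "('b, 'p) rm_model" and h :: "'a \<Rightarrow> 'i"
  assumes M: "routley_meyer_model Vars M" and N: "routley_meyer_model Vars N" and "inj h"
  defines "F \<equiv> (formulas Vars :: ('p, 'i) fm set)"
  shows "directed_clauses Vars M N (theory_incl F M N) (theory_incl F N M)"
  unfolding directed_clauses_def
proof (intro conjI allI ballI impI)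
  fix x y assume xy: "(x, y) \<in> theory_incl F M N"
  have "sat M (star M x) \<phi>" if "\<phi> \<in> F" "sat N (star N y) \<phi>" for \<phi>
  proof -
    have "Neg \<phi> \<in> F" using that(1) unfolding F_def by (rule formulas.Neg)
    then have "sat M x (Neg \<phi>) \<longrightarrow> sat N y (Neg \<phi>)" using xy unfolding theory_incl_def by blast
    with that(2) show ?thesis by simp
  qed
  then show "(star N y, star M x) \<in> theory_incl F N M"
    using xy M N unfolding theory_incl_def routley_meyer_model_def by simp
next
  fix x y p assume "(x, y) \<in> theory_incl F M N" "p \<in> Vars" "x \<in> val M p"
  moreover from \<open>p \<in> Vars\<close> have "Var p \<in> F" unfolding F_def by (rule formulas.Var)
  ultimately show "y \<in> val N p" unfolding theory_incl_def by fastforce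
next
  fix x y b c assume xy: "(x, y) \<in> theory_incl F M N" and R: "(y, b, c) \<in> rel N"
  have bc: "b \<in> worlds N" "c \<in> worlds N"
    using R N unfolding routley_meyer_model_def by auto
  \<comment> \<open>The worlds ruled out as \<open>b'\<close> and as \<open>c'\<close>,
    respectively.\<close>
  define B where "B = {b' \<in> worlds M. (b, b') \<notin> theory_incl F N M}"
  define C where "C = {c' \<in> worlds M. (c', c) \<notin> theory_incl F M N}"
  have "\<forall>b'\<in>B. \<exists>\<phi>. \<phi> \<in> F \<and> sat N b \<phi> \<and> \<not> sat M b' \<phi>"
    using bc unfolding B_def theory_incl_def by blast
  then obtain \<beta> where \<beta>: "\<And>b'. b' \<in> B \<Longrightarrow> \<beta> b' \<in> F \<and> sat N b (\<beta> b') \<and> \<not> sat M b' (\<beta> b')"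
    by metis
  have "\<forall>c'\<in>C. \<exists>\<phi>. \<phi> \<in> F \<and> sat M c' \<phi> \<and> \<not> sat N c \<phi>"
    using bc unfolding C_def theory_incl_def by blast
  then obtain \<gamma> where \<gamma>: "\<And>c'. c' \<in> C \<Longrightarrow> \<gamma> c' \<in> F \<and> sat M c' (\<gamma> c') \<and> \<not> sat N c (\<gamma> c')"
    by metis
  \<comment> \<open>Each world \<open>w\<close> is represented by the index \<open>h w\<close>, and
    \<open>inv h\<close> recovers it; values off the images of \<open>B\<close> and \<open>C\<close>
    do not matter.\<close>
  define \<phi> where "\<phi> = Conj (h ` B) (\<lambda>i. \<beta> (inv h i))"
  define \<psi> where "\<psi> = Disj (h ` C) (\<lambda>i. \<gamma> (inv h i))"
  have "Imp \<phi> \<psi> \<in> F"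
    using \<open>inj h\<close> \<beta> \<gamma> unfolding \<phi>_def \<psi>_def F_def by (auto intro!: formulas.intros)
  moreover have "sat N b \<phi>" "\<not> sat N c \<psi>"
    using \<beta> \<gamma> by (auto simp: \<phi>_def \<psi>_def \<open>inj h\<close>)
  then have "\<not> sat N y (Imp \<phi> \<psi>)" using R by auto
  ultimately have "\<not> sat M x (Imp \<phi> \<psi>)" using xy unfolding theory_incl_def by blast
  then obtain b' c' where R': "(x, b', c') \<in> rel M" and "sat M b' \<phi>" "\<not> sat M c' \<psi>" by auto
  \<comment> \<open>A \<open>b'\<close> in \<open>B\<close> would falsify its own conjunct
    \<open>\<beta> b'\<close>, and a \<open>c'\<close> in \<open>C\<close> would satisfy its own
    disjunct \<open>\<gamma> c'\<close>.\<close>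
  then have "b' \<notin> B" "c' \<notin> C"
    using \<beta> \<gamma> by (auto simp: \<phi>_def \<psi>_def \<open>inj h\<close>)
  moreover have "b' \<in> worlds M" "c' \<in> worlds M"
    using R' M unfolding routley_meyer_model_def by auto
  ultimately show "\<exists>b' c'. (x, b', c') \<in> rel M \<and> (b, b') \<in> theory_incl F N M \<and>
      (c', c) \<in> theory_incl F M N"
    using R' unfolding B_def C_def by blast
qed

lemma relevant_directed_bisimulation_commute:
  "relevant_directed_bisimulation Vars M N Z Z' \<longleftrightarrow> relevant_directed_bisimulation Vars N M Z' Z"
  unfolding relevant_directed_bisimulation_def by blast

lemma relevant_karp:
  fixes M :: "('a, 'p) rm_model" and N :: "('b, 'p) rm_model"
    and h :: "'a \<Rightarrow> 'i" and k :: "'b \<Rightarrow> 'i"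
  assumes M: "routley_meyer_model Vars M" and x: "x \<in> worlds M"
    and N: "routley_meyer_model Vars N" and y: "y \<in> worlds N"
    and "inj h" and "inj k"
  shows "(\<forall>\<phi> \<in> (formulas Vars :: ('p, 'i) fm set). sat M x \<phi> \<longrightarrow> sat N y \<phi>)
    \<longleftrightarrow> (\<exists>Z Z'. relevant_directed_bisimulation Vars M N Z Z' \<and> (x, y) \<in> Z)"
    (is "?L \<longleftrightarrow> ?R")
proof
  assume ?L
  let ?F = "formulas Vars :: ('p, 'i) fm set"
  let ?Z = "theory_incl ?F M N" and ?Z' = "theory_incl ?F N M"
  have xy: "(x, y) \<in> ?Z" using \<open>?L\<close> x y unfolding theory_incl_def by blast
  have d: "directed_clauses Vars M N ?Z ?Z'"
    using M N \<open>inj h\<close> by (rule directed_clauses_theory_incl)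
  have d': "directed_clauses Vars N M ?Z' ?Z"
    using N M \<open>inj k\<close> by (rule directed_clauses_theory_incl)
  \<comment> \<open>The star clause turns the given pair into an element of \<open>?Z'\<close>,
    which is therefore non-empty.\<close>
  have "(star N y, star M x) \<in> ?Z'" using d xy unfolding directed_clauses_def by blast
  moreover have "?Z \<subseteq> worlds M \<times> worlds N" "?Z' \<subseteq> worlds N \<times> worlds M"
    unfolding theory_incl_def by auto
  ultimately have "relevant_directed_bisimulation Vars M N ?Z ?Z'"
    using xy d d' unfolding relevant_directed_bisimulation_def by blast
  with xy show ?R by blast
next
  assume ?R
  then obtain Z Z' where "directed_clauses Vars M N Z Z'" "directed_clauses Vars N M Z' Z"
    and "(x, y) \<in> Z"
    unfolding relevant_directed_bisimulation_def by blast
  then show ?L using sat_preserved by blast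
qed

theorem theorem7:
  fixes Vars :: "'p set"
    and M1 :: "('a, 'p) rm_model" and M2 :: "('b, 'p) rm_model"
    and w1 :: 'a and w2 :: 'b
  assumes "routley_meyer_model Vars M1" and "w1 \<in> worlds M1"
    and "routley_meyer_model Vars M2" and "w2 \<in> worlds M2"
  shows "((\<forall>\<phi> \<in> (formulas Vars :: ('p, 'a + 'b + 'i) fm set). sat M1 w1 \<phi> \<longrightarrow> sat M2 w2 \<phi>)
            \<longleftrightarrow> (\<exists>Z1 Z2. relevant_directed_bisimulation Vars M1 M2 Z1 Z2 \<and> (w1, w2) \<in> Z1))
       \<and> ((\<forall>\<phi> \<in> (formulas Vars :: ('p, 'a + 'b + 'i) fm set). sat M2 w2 \<phi> \<longrightarrow> sat M1 w1 \<phi>)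
            \<longleftrightarrow> (\<exists>Z1 Z2. relevant_directed_bisimulation Vars M1 M2 Z1 Z2 \<and> (w2, w1) \<in> Z2))"
proof -
  have h: "inj (Inl :: 'a \<Rightarrow> 'a + 'b + 'i)" and k: "inj (Inr \<circ> Inl :: 'b \<Rightarrow> 'a + 'b + 'i)"
    by (auto intro: injI)
  \<comment> \<open>The second equivalence is the first with the two models exchanged; the symmetry
    of bisimulations restores their order.\<close>
  show ?thesis
    using relevant_karp[OF assms h k] relevant_karp[OF assms(3,4,1,2) k h]
    unfolding relevant_directed_bisimulation_commute[of Vars M2 M1] by blast
qed

end
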